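(* Let $\alpha\in\mathbb{R}\setminus\mathbb{Q}$, let $r_\alpha:S^1\to S^1$ be the rotation by $\alpha$, let $I\subset S^1$ be a finite union of closed intervals with nonempty interiors, $I\neq\emptyset$, $I\neq S^1$, and let $(a_0,a_1,\ldots)$ be the itinerary of $0$ under $r_\alpha$ relative to $I$. Then $$I=\overline{\{\,i\cdot\alpha \bmod 1 : i\ge 0,\ a_i=1\,\}},$$ where the bar denotes closure in $S^1$.
   Context: $S^1=\mathbb{R}/\mathbb{Z}$ and $r_\alpha(z)=z+\alpha \bmod 1$. A closed interval in $S^1$ is a closed arc. The itinerary of $0$ under $r_\alpha$ relative to $I$ is the sequence $(a_0,a_1,a_2,\ldots)$ with $a_i=1$ if $r_\alpha^i(0)\in I$ and $a_i=0$ otherwise. *)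

theory Defs
  imports "HOL-Analysis.Analysis"
begin

quotient_type circle = real / "\<lambda>x y :: real. x - y \<in> \<int>"
  morphisms rep_circle circle_of_real
proof (rule equivpI)
  show "reflp (\<lambda>x y :: real. x - y \<in> \<int>)"
    by (simp add: reflp_def)
  show "symp (\<lambda>x y :: real. x - y \<in> \<int>)"
  proof (rule sympI)
    fix x y :: real
    assume "x - y \<in> \<int>"
    then have "- (x - y) \<in> \<int>" by (rule Ints_minus)
    then show "y - x \<in> \<int>" by simp
  qed
  show "transp (\<lambda>x y :: real. x - y \<in> \<int>)"
  proof (rule transpI)
    fix x y z :: real
    assume "x - y \<in> \<int>" "y - z \<in> \<int>"
    then have "(x - y) + (y - z) \<in> \<int>" by (rule Ints_add)
    then show "x - z \<in> \<int>" by simp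
  qed
qed

(* The quotient topology. *)
instantiation circle :: topological_space
begin

definition open_circle :: "circle set \<Rightarrow> bool" where
  "open_circle U \<longleftrightarrow> open (circle_of_real -` U)"

instance
proof
  show "open (UNIV :: circle set)"
    by (simp add: open_circle_def)
  show "open (S \<inter> T)" if "open S" "open T" for S T :: "circle set"
    using that by (simp add: open_circle_def open_Int)
  show "open (\<Union>K)" if "\<forall>S\<in>K. open S" for K :: "circle set set"
    using that by (auto simp: open_circle_def vimage_Union)
qed

end

lift_definition rotation :: "real \<Rightarrow> circle \<Rightarrow> circle" is "\<lambda>\<alpha> z. z + \<alpha>"
  by simp

(* Positively oriented arc from a to b. The degenerate cases are a point (a = b)
   and the whole circle (b = a + 1). *)
definition closed_arc :: "circle set \<Rightarrow> bool" where
  "closed_arc A \<longleftrightarrow> (\<exists>a b. a \<le> b \<and> b \<le> a + 1 \<and> A = circle_of_real ` {a..b})"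

definition itinerary :: "('a \<Rightarrow> 'a) \<Rightarrow> 'a set \<Rightarrow> 'a \<Rightarrow> nat \<Rightarrow> nat" where
  "itinerary f I z i = (if (f ^^ i) z \<in> I then 1 else 0)"

end

theory Submission
  imports Defs
begin

text \<open>A closed arc with nonempty interior is the image of a nondegenerate interval \<open>{a..b}\<close>, and
  every neighbourhood of each of its points meets the image of \<open>{a<..<b}\<close> in a nonempty open set.
  By Kronecker's theorem the forward orbit of 0 enters that set, so the orbit points lying in the
  arc are dense in it.\<close>

lemma circle_of_real_eq_iff: "circle_of_real x = circle_of_real y \<longleftrightarrow> x - y \<in> \<int>"
  using circle.abs_eq_iff .

lemma open_circle_iff: "open U \<longleftrightarrow> open (circle_of_real -` U)"
  by (fact open_circle_def)

text \<open>The double union is the sum of \<open>S\<close> and the integers, in the shape to which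
  \<open>compact_closed_sums\<close> applies.\<close>

lemma vimage_circle_of_real_image:
  "circle_of_real -` circle_of_real ` S = (\<Union>x\<in>S. \<Union>n\<in>\<int>. {x + n})" (is "?L = ?R")
proof
  show "?L \<subseteq> ?R"
  proof
    fix y assume "y \<in> ?L"
    then obtain x where x: "x \<in> S" "y - x \<in> \<int>"
      by (auto simp: circle_of_real_eq_iff)
    show "y \<in> ?R"
      by (rule UN_I[OF x(1)], rule UN_I[OF x(2)]) simp
  qed
  show "?R \<subseteq> ?L"
  proof
    fix y assume "y \<in> ?R"
    then obtain x n where "x \<in> S" "n \<in> \<int>" "y = x + n" by blast
    then have "circle_of_real y = circle_of_real x" by (simp add: circle_of_real_eq_iff)
    with \<open>x \<in> S\<close> show "y \<in> ?L" by simp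
  qed
qed

text \<open>The sum of a compact set and the closed set \<int> is closed. Closedness of
  \<open>S\<close> would not suffice: the points n + 1/n with n \<ge> 2 form a closed set whose
  image accumulates at the class of 0 without containing it.\<close>

lemma closed_circle_of_real_image:
  assumes "compact S"
  shows "closed (circle_of_real ` S)"
proof -
  have "closed (circle_of_real -` circle_of_real ` S)"
    unfolding vimage_circle_of_real_image using assms by (intro compact_closed_sums) auto
  then show ?thesis
    by (simp add: closed_def open_circle_iff vimage_Compl)
qed

lemma closed_arc_imp_closed: "closed_arc A \<Longrightarrow> closed A"
  unfolding closed_arc_def by (auto intro: closed_circle_of_real_image)

text \<open>A fibre of the projection is a translate of \<int>, which contains no ball. This
  excludes the degenerate arcs with a = b.\<close>

lemma interior_circle_singleton: "interior {p :: circle} = {}"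
proof (rule ccontr)
  assume "interior {p} \<noteq> {}"
  then have "interior {p} = {p}"
    using interior_subset[of "{p}"] by blast
  then have "open {p}"
    using open_interior[of "{p}"] by simp
  obtain c where c: "p = circle_of_real c"
    using Quotient3_abs_rep[OF Quotient3_circle] by metis
  have "open (circle_of_real -` {p})"
    using \<open>open {p}\<close> open_circle_iff by blast
  moreover have "c \<in> circle_of_real -` {p}" by (simp add: c)
  ultimately obtain e where "e > 0" and e: "ball c e \<subseteq> circle_of_real -` {p}"
    by (meson open_contains_ball)
  \<comment> \<open>Small enough to stay in the ball, and strictly between 0 and 1, hence not an
    integer.\<close>
  define d where "d = min (e / 2) (1 / 2)"
  have d: "0 < d" "d < e" "d < 1" using \<open>e > 0\<close> by (auto simp: d_def)
  then have "c + d \<in> ball c e" by (simp add: dist_real_def)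
  then have "circle_of_real (c + d) = circle_of_real c" using e c by blast
  then have "d \<in> \<int>" by (simp add: circle_of_real_eq_iff)
  with d show False by (auto elim!: Ints_cases)
qed

lemma closed_arc_nondegenerate:
  assumes "closed_arc A" "interior A \<noteq> {}"
  obtains a b where "a < b" "A = circle_of_real ` {a..b}"
proof -
  obtain a b where ab: "a \<le> b" "A = circle_of_real ` {a..b}"
    using assms(1) unfolding closed_arc_def by blast
  have "a \<noteq> b" using ab assms(2) interior_circle_singleton by auto
  with ab have "a < b" by simp
  from this ab(2) show thesis by (rule that)
qed

lemma rotation_funpow_0: "(rotation \<alpha> ^^ i) (circle_of_real 0) = circle_of_real (real i * \<alpha>)"
  by (induction i) (simp_all add: rotation.abs_eq algebra_simps)

text \<open>Kronecker's theorem, with \<open>U\<close> open in the reals rather than in the circle: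
  the representative \<open>y\<close> can then be placed in a chosen real interval, and no openness
  of the projection has to be shown.\<close>

lemma forward_orbit_meets_open:
  assumes "\<alpha> \<notin> \<rat>" "open U" "x \<in> U"
  obtains i :: nat and y where "y \<in> U" "circle_of_real (real i * \<alpha>) = circle_of_real y"
proof -
  obtain e where "e > 0" and e: "ball x e \<subseteq> U"
    using assms by (meson open_contains_ball)
  obtain h k where "k > 0" and hk: "\<bar>of_int k * \<alpha> - of_int h - x\<bar> < e"
    using sequence_of_fractional_parts_is_dense[OF assms(1) \<open>e > 0\<close>] .
  have "of_int k * \<alpha> - of_int h \<in> U"
    using hk e by (auto simp: subset_iff dist_real_def abs_minus_commute)
  \<comment> \<open>The integer \<open>h\<close> vanishes modulo 1, and positivity of
    \<open>k\<close> makes this a point of the forward orbit.\<close>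
  moreover have "circle_of_real (real (nat k) * \<alpha>) = circle_of_real (of_int k * \<alpha> - of_int h)"
    using \<open>k > 0\<close> by (simp add: circle_of_real_eq_iff)
  ultimately show thesis using that by blast
qed

lemma closed_arc_subset_closure_orbit:
  assumes "\<alpha> \<notin> \<rat>" "closed_arc A" "interior A \<noteq> {}"
  shows "A \<subseteq> closure {circle_of_real (real i * \<alpha>) | i. circle_of_real (real i * \<alpha>) \<in> A}"
    (is "_ \<subseteq> closure ?O")
proof
  fix p assume "p \<in> A"
  obtain a b where "a < b" and A: "A = circle_of_real ` {a..b}"
    using closed_arc_nondegenerate assms(2,3) .
  then obtain t where t: "t \<in> {a..b}" "p = circle_of_real t"
    using \<open>p \<in> A\<close> by blast
  have "?O \<inter> U \<noteq> {}" if "open U" "p \<in> U" for U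
  proof -
    have V: "open (circle_of_real -` U)" "t \<in> circle_of_real -` U"
      using that t open_circle_iff by auto
    \<comment> \<open>The point \<open>t\<close> may be an endpoint of the interval, so it is
      approached from the open interval, where there is room for a real neighbourhood.\<close>
    have "t \<in> closure {a<..<b}" using t \<open>a < b\<close> by simp
    with V have "circle_of_real -` U \<inter> {a<..<b} \<noteq> {}"
      using open_Int_closure_eq_empty by blast
    then obtain s where s: "s \<in> circle_of_real -` U \<inter> {a<..<b}" by blast
    obtain i y where y: "y \<in> circle_of_real -` U \<inter> {a<..<b}"
      and iy: "circle_of_real (real i * \<alpha>) = circle_of_real y"
      using forward_orbit_meets_open[OF assms(1) _ s] V(1) by (metis open_Int open_greaterThanLessThan)
    have "circle_of_real (real i * \<alpha>) \<in> A" "circle_of_real (real i * \<alpha>) \<in> U"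
      using y A unfolding iy by auto
    then show ?thesis by blast
  qed
  then show "p \<in> closure ?O"
    unfolding closure_iff_nhds_not_empty by blast
qed

theorem theorem7:
  fixes \<alpha> :: real and I :: "circle set" and \<A> :: "circle set set" and a :: "nat \<Rightarrow> nat"
  assumes "\<alpha> \<notin> \<rat>"
    and "finite \<A>"
    and "\<And>A. A \<in> \<A> \<Longrightarrow> closed_arc A \<and> interior A \<noteq> {}"
    and "I = \<Union>\<A>"
    and "I \<noteq> {}"
    and "I \<noteq> UNIV"
    and "a = itinerary (rotation \<alpha>) I (circle_of_real 0)"
  shows "I = closure {circle_of_real (real i * \<alpha>) | i. a i = 1}"
proof -
  have "a i = 1 \<longleftrightarrow> circle_of_real (real i * \<alpha>) \<in> I" for i
    by (simp add: assms(7) itinerary_def rotation_funpow_0)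
  then have orbit: "{circle_of_real (real i * \<alpha>) | i. a i = 1} =
      {circle_of_real (real i * \<alpha>) | i. circle_of_real (real i * \<alpha>) \<in> I}" (is "_ = ?O")
    by presburger
  \<comment> \<open>Finiteness of the family enters here.\<close>
  have "closed I"
    unfolding assms(4) using assms(2,3) by (intro closed_Union) (auto intro: closed_arc_imp_closed)
  then have "closure ?O \<subseteq> I"
    by (intro closure_minimal) auto
  moreover have "A \<subseteq> closure ?O" if "A \<in> \<A>" for A
  proof -
    have "A \<subseteq> closure {circle_of_real (real i * \<alpha>) | i. circle_of_real (real i * \<alpha>) \<in> A}"
      using closed_arc_subset_closure_orbit assms(1,3) that by blast
    \<comment> \<open>Orbit points in one arc are among those in the union.\<close>
    also have "\<dots> \<subseteq> closure ?O"
      using that assms(4) by (intro closure_mono) blast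
    finally show ?thesis .
  qed
  ultimately show ?thesis
    unfolding orbit using assms(4) by blast
qed

end
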